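(* Let $\eta$ and $\beta$ be nonzero (real or complex) constants, and let $\alpha$ be a (real or complex) constant with $\alpha\neq-1$ and $\alpha\ne-\beta-1$. Then $$\int x^\alpha \sin(\eta x^\beta)\,dx=\frac{x^{\alpha+1}}{(\alpha+1)(\alpha+\beta+1)}\Bigl[\sin(\eta x^\beta)\;{}_1F_2\Bigl(1; \frac{\alpha+\beta+1}{2\beta}, \frac{\alpha+2\beta+1}{2\beta}; -\frac{\eta^2 x^{2\beta}}{4}\Bigr)- \beta\eta x^{\beta}\cos(\eta x^\beta)\;{}_1F_2\Bigl(1; \frac{\alpha+2\beta+1}{2\beta}, \frac{\alpha+3\beta+1}{2\beta}; -\frac{\eta^2 x^{2\beta}}{4}\Bigr)\Bigr]+C,$$ where $C$ is an arbitrary constant of integration.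
   Context: The hypergeometric function ${}_1F_2$ is ${}_1F_2(a;b,c;x)=\sum_{n=0}^{\infty}\frac{(a)_n}{(b)_n(c)_n}\frac{x^n}{n!}$, where $(\vartheta)_n=\Gamma(\vartheta+n)/\Gamma(\vartheta)$, $(\vartheta)_0=1$ (Pochhammer symbol). The integral is an indefinite integral (antiderivative) with respect to $x$.
   Formalization: The printed formula is false (e.g. α=0, β=η=1): a factor (α+β+1) is restored before the sine term. The lower parameters of the 1F2's are assumed not to be non-positive integers, where they are undefined; x ranges over a domain or interval, without 0, carrying a branch of log. *)

theory Defs
  imports "HOL-Analysis.Analysis"
begin

text \<open>Meaningful only if neither \<open>b\<close> nor \<open>c\<close> is a non-positive integer: for such parameters
  division by zero silently truncates the series.\<close>

definition hyp1F2 :: "complex \<Rightarrow> complex \<Rightarrow> complex \<Rightarrow> complex \<Rightarrow> complex" where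
  "hyp1F2 a b c z =
     (\<Sum>n. pochhammer a n / (pochhammer b n * pochhammer c n) * (z ^ n / fact n))"

text \<open>All powers in one formula are taken with respect to one continuous branch \<open>L\<close> of the logarithm.
  With \<open>L = Ln\<close> this is the principal power; integer exponents give the usual power for every
  branch, so that negative reals can belong to the domain.\<close>

definition log_branch :: "complex set \<Rightarrow> (complex \<Rightarrow> complex) \<Rightarrow> bool" where
  "log_branch S L \<longleftrightarrow> continuous_on S L \<and> (\<forall>x\<in>S. exp (L x) = x)"

definition cpow :: "(complex \<Rightarrow> complex) \<Rightarrow> complex \<Rightarrow> complex \<Rightarrow> complex" where
  "cpow L x a = exp (a * L x)"

lemma cpow_Ln: "x \<noteq> 0 \<Longrightarrow> cpow Ln x a = x powr a"
  by (simp add: cpow_def powr_def)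

lemma cpow_Ln_of_real: "x > 0 \<Longrightarrow> cpow Ln (of_real x) (of_real a) = of_real (x powr a)"
  by (simp add: cpow_Ln powr_of_real)

lemma cpow_of_int: "log_branch S L \<Longrightarrow> x \<in> S \<Longrightarrow> cpow L x (of_int n) = x powi n"
  by (metis cpow_def log_branch_def exp_power_int mult.commute)

lemma log_branch_Ln: "log_branch (- \<real>\<^sub>\<le>\<^sub>0) Ln"
  unfolding log_branch_def
  by (auto intro!: continuous_intros exp_Ln)

text \<open>The variable of integration is either complex, ranging over a domain, or real, ranging over
  an open interval.\<close>

definition integration_domain :: "complex set \<Rightarrow> bool" where
  "integration_domain S \<longleftrightarrow>
     open S \<and> connected S \<or>
     (\<exists>I :: real set. open I \<and> connected I \<and> S = of_real ` I)"

text \<open>The indefinite integral is the set of all antiderivatives; the values outside \<open>S\<close> are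
  irrelevant. On a real interval the derivative within \<open>S\<close> is the derivative of a complex-valued
  function of a real variable.\<close>

definition indefinite_integral :: "complex set \<Rightarrow> (complex \<Rightarrow> complex) \<Rightarrow> (complex \<Rightarrow> complex) set"
  where "indefinite_integral S f =
    {G. \<forall>x\<in>S. (G has_field_derivative f x) (at x within S)}"

lemma indefinite_integral_of_real:
  "G \<in> indefinite_integral (of_real ` I) f \<longleftrightarrow>
     (\<forall>t\<in>I. ((\<lambda>t. G (of_real t)) has_vector_derivative f (of_real t)) (at t within I))"
proof -
  have bl: "bounded_linear (\<lambda>s. c * complex_of_real s)" for c
    by (intro bounded_linear_const_mult bounded_linear_of_real)
  have "(G has_field_derivative c) (at (of_real t) within of_real ` I) \<longleftrightarrow>
        ((\<lambda>t. G (of_real t)) has_vector_derivative c) (at t within I)" for t c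
  proof -
    have "(G has_field_derivative c) (at (of_real t) within of_real ` I) \<longleftrightarrow>
      (\<forall>e>0. \<exists>d>0. \<forall>s\<in>I. norm (of_real s - (of_real t :: complex)) < d \<longrightarrow>
         norm (G (of_real s) - G (of_real t) - c * (of_real s - of_real t))
           \<le> e * norm (of_real s - (of_real t :: complex)))"
      unfolding has_field_derivative_def has_derivative_within_alt
      by (simp add: bounded_linear_mult_right)
    also have "\<dots> \<longleftrightarrow> ((\<lambda>t. G (of_real t)) has_vector_derivative c) (at t within I)"
      unfolding has_vector_derivative_def has_derivative_within_alt
      by (simp add: bl scaleR_conv_of_real mult.commute
               flip: of_real_diff)
    finally show ?thesis .
  qed
  then show ?thesis
    by (simp add: indefinite_integral_def)
qed

text \<open>Integrating \<open>x powr \<alpha> * sin (\<eta> * x powr \<beta>)\<close> by parts twice gives a sine term with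
  prefactor \<open>1 / (\<alpha> + 1)\<close> and a cosine term with prefactor \<open>1 / ((\<alpha> + 1) * (\<alpha> + \<beta> + 1))\<close>. With the
  common prefactor \<open>1 / ((\<alpha> + 1) * (\<alpha> + \<beta> + 1))\<close> pulled out, the sine term therefore carries a
  factor \<open>\<alpha> + \<beta> + 1\<close>. The source omits this factor, and the formula is false without it: for
  \<open>\<alpha> = 0\<close> and \<open>\<beta> = \<eta> = 1\<close> its right-hand side would be \<open>(1 + (cos x)^2 - 2 * cos x) / 2\<close>.\<close>

end

theory Submission
  imports Defs
begin

text \<open>Put \<open>u = \<eta> x powr \<beta>\<close>, \<open>z = - u\<^sup>2 / 4\<close>, and let \<open>F\<close> and \<open>G\<close> be the two hypergeometric functions,
  with parameters \<open>(b, c)\<close> and \<open>(c, b + 1)\<close>. The contiguous relations \<open>(\<theta> + b) G = b F\<close> and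
  \<open>(\<theta> + c - 1) F = c - 1 + (z / b) G\<close>, where \<open>\<theta> = z d/dz\<close>, are read off the coefficients. When the
  claimed antiderivative is differentiated, the first one annihilates the cosine terms and the second
  one reduces the sine terms to the integrand. Two antiderivatives differ by a constant because the
  domain is connected.\<close>

section \<open>Power series with first parameter 1: convergence and termwise differentiation\<close>

lemma hyp1F2_1: "hyp1F2 1 b c z = (\<Sum>n. inverse (pochhammer b n * pochhammer c n) * z ^ n)"
  unfolding hyp1F2_def
  by (intro suminf_cong) (simp add: divide_inverse flip: pochhammer_fact)

text \<open>The ratio of consecutive terms is \<open>z\<close> / ((b + n)(c + n)), which tends to 0.
  For exceptional \<open>b\<close> or \<open>c\<close> this recursion survives, because
  \<open>inverse 0 = 0\<close> makes all later terms vanish.\<close>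

lemma summable_hyp1F2_1:
  fixes b c z :: complex
  shows "summable (\<lambda>n. inverse (pochhammer b n * pochhammer c n) * z ^ n)"
proof -
  have inv: "(\<lambda>n. inverse (d + of_nat n)) \<longlonglongrightarrow> 0" for d :: complex
    by (intro tendsto_inverse_0 [THEN filterlim_compose]
          tendsto_add_filterlim_at_infinity [OF tendsto_const] tendsto_of_nat)
  have "(\<lambda>n. z * (inverse (b + of_nat n) * inverse (c + of_nat n))) \<longlonglongrightarrow> z * (0 * 0)"
    by (intro tendsto_intros inv)
  then have "\<forall>\<^sub>F n in sequentially. norm (z * (inverse (b + of_nat n) * inverse (c + of_nat n))) < 1 / 2"
    by (auto simp: tendsto_iff dist_norm simp del: norm_mult dest: spec [where x = "1 / 2"])
  then obtain N where
    N: "\<And>n. n \<ge> N \<Longrightarrow> norm (z * (inverse (b + of_nat n) * inverse (c + of_nat n))) < 1 / 2"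
    by (auto simp: eventually_sequentially)
  let ?f = "\<lambda>n. inverse (pochhammer b n * pochhammer c n) * z ^ n"
  show ?thesis
  proof (rule summable_ratio_test [of "1 / 2" N])
    fix n assume "n \<ge> N"
    have "?f (Suc n) = (z * (inverse (b + of_nat n) * inverse (c + of_nat n))) * ?f n"
      by (simp add: pochhammer_Suc mult_ac)
    then have "norm (?f (Suc n)) =
        norm (z * (inverse (b + of_nat n) * inverse (c + of_nat n))) * norm (?f n)"
      by (metis norm_mult)
    also have "\<dots> \<le> 1 / 2 * norm (?f n)"
      using N [OF \<open>n \<ge> N\<close>] by (intro mult_right_mono) auto
    finally show "norm (?f (Suc n)) \<le> 1 / 2 * norm (?f n)" .
  qed auto
qed

text \<open>The factor \<open>z\<close> undoes the index shift of differentiation, so that \<theta>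
  acts diagonally: it multiplies the n-th term by n.\<close>

lemma power_series_euler_operator:
  fixes a :: "nat \<Rightarrow> complex"
  assumes "\<And>z. summable (\<lambda>n. a n * z ^ n)"
  obtains D where "((\<lambda>z. \<Sum>n. a n * z ^ n) has_field_derivative D) (at z)"
    and "(\<lambda>n. of_nat n * (a n * z ^ n)) sums (z * D)"
proof
  let ?D = "\<Sum>n. diffs a n * z ^ n"
  show "((\<lambda>z. \<Sum>n. a n * z ^ n) has_field_derivative ?D) (at z)"
    using assms by (rule termdiffs_strong_converges_everywhere)
  have "summable (\<lambda>n. diffs a n * z ^ n)"
    using assms by (rule termdiff_converges_all)
  then have "(\<lambda>n. z * (of_nat n * a n * z ^ (n - Suc 0))) sums (z * ?D)"
    by (intro sums_mult diffs_equiv)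
  \<comment> \<open>At n = 0 the exponent is truncated to 0, but the factor \<open>of_nat 0\<close>
    makes both sides vanish.\<close>
  moreover have "z * (of_nat n * a n * z ^ (n - Suc 0)) = of_nat n * (a n * z ^ n)" for n
    by (cases n) auto
  ultimately show "(\<lambda>n. of_nat n * (a n * z ^ n)) sums (z * ?D)"
    by simp
qed

lemma hyp1F2_1_field_differentiable: "hyp1F2 1 b c field_differentiable (at z)"
  unfolding hyp1F2_1 [abs_def] field_differentiable_def
  using power_series_euler_operator [OF summable_hyp1F2_1] by metis

lemma hyp1F2_1_DERIV:
  "(hyp1F2 1 b c has_field_derivative deriv (hyp1F2 1 b c) z) (at z)"
  using hyp1F2_1_field_differentiable by (simp add: DERIV_deriv_iff_field_differentiable)

text \<open>Since \<theta> + d multiplies the n-th term by n + d, a first-order differential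
  relation becomes a comparison of coefficients.\<close>

lemma hyp1F2_1_shifted_euler_sums:
  "(\<lambda>n. (of_nat n + d) * (inverse (pochhammer b n * pochhammer c n) * z ^ n)) sums
     (z * deriv (hyp1F2 1 b c) z + d * hyp1F2 1 b c z)"
proof -
  obtain D where "(hyp1F2 1 b c has_field_derivative D) (at z)"
    and D: "(\<lambda>n. of_nat n * (inverse (pochhammer b n * pochhammer c n) * z ^ n)) sums (z * D)"
    unfolding hyp1F2_1 [abs_def]
    by (rule power_series_euler_operator [OF summable_hyp1F2_1])
  then have "deriv (hyp1F2 1 b c) z = D"
    by (simp add: DERIV_imp_deriv)
  moreover have "(\<lambda>n. d * (inverse (pochhammer b n * pochhammer c n) * z ^ n)) sums
      (d * hyp1F2 1 b c z)"
    unfolding hyp1F2_1 by (intro sums_mult summable_sums summable_hyp1F2_1)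
  ultimately show ?thesis
    using sums_add [OF D] unfolding distrib_right by simp
qed

section \<open>Contiguous relations\<close>

lemma hyp1F2_1_contiguous_lower:
  assumes "b \<notin> \<int>\<^sub>\<le>\<^sub>0"
  shows "z * deriv (hyp1F2 1 c (b + 1)) z + b * hyp1F2 1 c (b + 1) z = b * hyp1F2 1 b c z"
proof (rule sums_unique2)
  have coeff: "(of_nat n + b) * inverse (pochhammer (b + 1) n) = b * inverse (pochhammer b n)" for n
  proof -
    \<comment> \<open>Both sides are \<open>pochhammer b (Suc n)\<close>, with the last or the first
      factor split off.\<close>
    have p: "pochhammer b n * (b + of_nat n) = b * pochhammer (b + 1) n"
      by (metis pochhammer_rec pochhammer_Suc)
    moreover have "pochhammer b n \<noteq> 0" "pochhammer b (Suc n) \<noteq> 0"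
      using assms by (auto dest: pochhammer_eq_0_imp_nonpos_Int)
    ultimately show ?thesis
      by (simp add: pochhammer_rec [of b] field_simps)
  qed
  have "(of_nat n + b) * (inverse (pochhammer c n * pochhammer (b + 1) n) * z ^ n) =
      b * (inverse (pochhammer b n * pochhammer c n) * z ^ n)" for n
    using arg_cong [OF coeff, of "\<lambda>t. t * (inverse (pochhammer c n) * z ^ n)" n]
    by (simp only: inverse_mult_distrib mult_ac)
  then show "(\<lambda>n. b * (inverse (pochhammer b n * pochhammer c n) * z ^ n)) sums
      (z * deriv (hyp1F2 1 c (b + 1)) z + b * hyp1F2 1 c (b + 1) z)"
    using hyp1F2_1_shifted_euler_sums [of b c "b + 1" z] by (simp only:)
  show "(\<lambda>n. b * (inverse (pochhammer b n * pochhammer c n) * z ^ n)) sums (b * hyp1F2 1 b c z)"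
    unfolding hyp1F2_1 by (intro sums_mult summable_sums summable_hyp1F2_1)
qed

text \<open>In the term of index n + 1 the factor n + c cancels the last factor of (c)_(n+1), and
  (b)_(n+1) = b (b+1)_n. So the tail is z / b times the other series, and the term of index 0 is c -
  1.\<close>

lemma hyp1F2_1_contiguous_raise:
  assumes "c \<notin> \<int>\<^sub>\<le>\<^sub>0"
  shows "z * deriv (hyp1F2 1 b c) z + (c - 1) * hyp1F2 1 b c z =
    c - 1 + z / b * hyp1F2 1 c (b + 1) z"
proof (rule sums_unique2)
  let ?t = "\<lambda>n. (of_nat n + (c - 1)) * (inverse (pochhammer b n * pochhammer c n) * z ^ n)"
  show "?t sums (z * deriv (hyp1F2 1 b c) z + (c - 1) * hyp1F2 1 b c z)"
    by (rule hyp1F2_1_shifted_euler_sums)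
  have "c + of_nat n \<noteq> 0" for n
    using assms plus_of_nat_eq_0_imp by blast
  then have "?t (Suc n) = z / b * (inverse (pochhammer c n * pochhammer (b + 1) n) * z ^ n)" for n
    by (simp add: pochhammer_rec [of b] pochhammer_Suc [of c] divide_inverse add_ac)
  moreover have "(\<lambda>n. z / b * (inverse (pochhammer c n * pochhammer (b + 1) n) * z ^ n)) sums
      (z / b * hyp1F2 1 c (b + 1) z)"
    unfolding hyp1F2_1 by (intro sums_mult summable_sums summable_hyp1F2_1)
  ultimately have "(\<lambda>n. ?t (Suc n)) sums (z / b * hyp1F2 1 c (b + 1) z)"
    by simp
  \<comment> \<open>Here \<open>sums_Suc_iff\<close> puts back the term of index 0.\<close>
  then show "?t sums (c - 1 + z / b * hyp1F2 1 c (b + 1) z)"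
    by (subst (asm) sums_Suc_iff) (simp add: add.commute)
qed

section \<open>Branches of the logarithm and their powers\<close>

lemma log_branch_nonzero: "log_branch S L \<Longrightarrow> x \<in> S \<Longrightarrow> x \<noteq> 0"
  by (metis exp_not_eq_zero log_branch_def)

text \<open>Near \<open>x\<close>, continuity keeps L y - L x inside the strip of imaginary part
  below pi in absolute value. There it must be the principal logarithm of y / x, so \<open>L\<close>
  inherits the derivative of \<open>Ln\<close>. Openness of \<open>S\<close> does not enter, so
  embedded real intervals are covered too.\<close>

lemma log_branch_has_field_derivative:
  assumes L: "log_branch S L" and x: "x \<in> S"
  shows "(L has_field_derivative 1 / x) (at x within S)"
proof -
  have x0: "x \<noteq> 0"
    using assms by (rule log_branch_nonzero)
  have "continuous (at x within S) L"
    using L x by (auto simp: log_branch_def continuous_on_eq_continuous_within)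
  then obtain d where "d > 0"
    and d: "\<And>y. y \<in> S \<Longrightarrow> dist y x < d \<Longrightarrow> dist (L y) (L x) < pi"
    unfolding continuous_within_eps_delta using pi_gt_zero by blast
  show ?thesis
  proof (rule has_field_derivative_transform_within [OF _ \<open>d > 0\<close> x])
    show "((\<lambda>y. L x + Ln (y / x)) has_field_derivative 1 / x) (at x within S)"
      using x0 by (auto intro!: derivative_eq_intros)
  next
    fix y assume y: "y \<in> S" "dist y x < d"
    have "\<bar>Im (L y - L x)\<bar> < pi"
      using d [OF y] abs_Im_le_cmod [of "L y - L x"] by (simp add: dist_norm)
    moreover have "exp (L y - L x) = y / x"
      using L x y by (simp add: log_branch_def exp_diff)
    ultimately have "Ln (y / x) = L y - L x"
      by (intro Ln_unique) auto
    then show "L x + Ln (y / x) = L y"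
      by simp
  qed
qed

lemma cpow_has_field_derivative:
  assumes "log_branch S L" and "x \<in> S"
  shows "((\<lambda>x. cpow L x a) has_field_derivative a * cpow L x a / x) (at x within S)"
  unfolding cpow_def
  by (rule derivative_eq_intros log_branch_has_field_derivative assms refl)+ simp

text \<open>Reduces the theorem to differentiating one function \<open>H\<close>. An embedded real
  interval is not open in the plane unless empty; there convexity of \<open>S\<close> yields the
  constant.\<close>

lemma indefinite_integral_eq:
  assumes S: "integration_domain S" and H: "H \<in> indefinite_integral S f"
  shows "indefinite_integral S f = {G. \<exists>C. \<forall>x\<in>S. G x = H x + C}"
proof (intro equalityI subsetI CollectI)
  fix G assume "G \<in> indefinite_integral S f"
  then have D: "((\<lambda>x. G x - H x) has_field_derivative 0) (at x within S)" if "x \<in> S" for x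
    using DERIV_diff [of G "f x" x S H "f x"] H that unfolding indefinite_integral_def by simp
  have "\<exists>C. \<forall>x\<in>S. G x - H x = C"
    using S unfolding integration_domain_def
  proof (elim disjE conjE exE)
    assume "open S" "connected S"
    have "((\<lambda>x. G x - H x) has_field_derivative 0) (at x)" if "x \<in> S" for x
      using D [OF that] at_within_open [OF that \<open>open S\<close>] by simp
    then have "(\<lambda>x. G x - H x) constant_on S"
      using \<open>connected S\<close> \<open>open S\<close> by (rule has_field_derivative_0_imp_constant_on)
    then show ?thesis
      unfolding constant_on_def .
  next
    fix I :: "real set" assume "connected I" "S = of_real ` I"
    have "convex I"
      using \<open>connected I\<close> is_interval_convex_1 is_interval_connected_1 by blast
    then have "convex S"
      unfolding \<open>S = of_real ` I\<close> by (rule convex_linear_image [OF linear_of_real])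
    then show ?thesis
      by (rule has_field_derivative_zero_constant [OF _ D])
  qed
  then show "\<exists>C. \<forall>x\<in>S. G x = H x + C"
    by (simp add: diff_eq_eq add.commute)
next
  fix G assume "G \<in> {G. \<exists>C. \<forall>x\<in>S. G x = H x + C}"
  then obtain C where C: "\<And>x. x \<in> S \<Longrightarrow> H x + C = G x"
    by auto
  have "(G has_field_derivative f x) (at x within S)" if "x \<in> S" for x
  \<comment> \<open>\<open>G\<close> and H + C agree on all of \<open>S\<close>, so any radius
    serves; 1 is chosen.\<close>
  proof (rule has_field_derivative_transform_within [OF _ zero_less_one that C])
    show "((\<lambda>x. H x + C) has_field_derivative f x) (at x within S)"
      using DERIV_add [of H "f x" x S "\<lambda>_. C" 0] H that by (simp add: indefinite_integral_def)
  qed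
  then show "G \<in> indefinite_integral S f"
    by (simp add: indefinite_integral_def)
qed

section \<open>Differentiation of the claimed antiderivative\<close>

theorem proposition5:
  fixes \<alpha> \<beta> \<eta> :: complex and S :: "complex set" and L :: "complex \<Rightarrow> complex"
  assumes "\<eta> \<noteq> 0" and "\<beta> \<noteq> 0"
    and "\<alpha> \<noteq> - 1" and "\<alpha> \<noteq> - \<beta> - 1"
    and "(\<alpha> + \<beta> + 1) / (2 * \<beta>) \<notin> \<int>\<^sub>\<le>\<^sub>0"
    and "(\<alpha> + 2 * \<beta> + 1) / (2 * \<beta>) \<notin> \<int>\<^sub>\<le>\<^sub>0"
    and "(\<alpha> + 3 * \<beta> + 1) / (2 * \<beta>) \<notin> \<int>\<^sub>\<le>\<^sub>0"
    and "integration_domain S" and "log_branch S L"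
  shows "indefinite_integral S (\<lambda>x. cpow L x \<alpha> * sin (\<eta> * cpow L x \<beta>)) =
    {G. \<exists>C. \<forall>x\<in>S. G x =
       cpow L x (\<alpha> + 1) / ((\<alpha> + 1) * (\<alpha> + \<beta> + 1)) *
         ((\<alpha> + \<beta> + 1) * sin (\<eta> * cpow L x \<beta>) *
            hyp1F2 1 ((\<alpha> + \<beta> + 1) / (2 * \<beta>)) ((\<alpha> + 2 * \<beta> + 1) / (2 * \<beta>))
              (- (\<eta>\<^sup>2 * cpow L x (2 * \<beta>) / 4))
          - \<beta> * \<eta> * cpow L x \<beta> * cos (\<eta> * cpow L x \<beta>) *
            hyp1F2 1 ((\<alpha> + 2 * \<beta> + 1) / (2 * \<beta>)) ((\<alpha> + 3 * \<beta> + 1) / (2 * \<beta>))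
              (- (\<eta>\<^sup>2 * cpow L x (2 * \<beta>) / 4))) + C}"
proof (rule indefinite_integral_eq [OF \<open>integration_domain S\<close>], unfold indefinite_integral_def,
    intro CollectI ballI)
  fix x assume x: "x \<in> S"
  let ?b = "(\<alpha> + \<beta> + 1) / (2 * \<beta>)" and ?c = "(\<alpha> + 2 * \<beta> + 1) / (2 * \<beta>)"
  let ?e = "(\<alpha> + 3 * \<beta> + 1) / (2 * \<beta>)"
  define F where "F = hyp1F2 1 ?b ?c"
  define G where "G = hyp1F2 1 ?c ?e"
  define p where "p = cpow L x \<alpha>"
  define q where "q = cpow L x \<beta>"
  define z where "z = - (\<eta>\<^sup>2 * cpow L x (2 * \<beta>) / 4)"
  have x0: "x \<noteq> 0"
    using \<open>log_branch S L\<close> x by (rule log_branch_nonzero)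
  have nz: "\<alpha> + 1 \<noteq> 0" "\<alpha> + \<beta> + 1 \<noteq> 0"
    using assms(3,4) by (auto simp: add_eq_0_iff2 eq_diff_eq add.assoc)
  \<comment> \<open>This makes \<open>F\<close> and \<open>G\<close> the pair with parameters (b, c)
    and (c, b + 1) of the contiguous relations.\<close>
  have e: "?e = ?b + 1"
    using assms(2) by (simp add: field_simps)
  have q2: "cpow L x (2 * \<beta>) = q\<^sup>2"
    by (simp add: cpow_def q_def exp_double [symmetric] mult.assoc)
  have p1: "cpow L x (\<alpha> + 1) = x * p"
    using assms(9) x by (simp add: cpow_def p_def log_branch_def algebra_simps exp_add)
  \<comment> \<open>As \<open>z\<close> is a constant multiple of the power of x with exponent
    2\<beta>, the operator 2\<beta>\<theta> is x d/dx; both relations are rescaled to it.\<close>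
  have contigG: "2 * \<beta> * (z * deriv G z) = (\<alpha> + \<beta> + 1) * (F z - G z)"
    using hyp1F2_1_contiguous_lower [OF assms(5), of z ?c] assms(2)
    unfolding F_def G_def e by (simp add: field_simps)
  have contigF: "(\<alpha> + \<beta> + 1) * (2 * \<beta> * (z * deriv F z)) =
      (\<alpha> + \<beta> + 1) * (\<alpha> + 1) * (1 - F z) + 4 * \<beta>\<^sup>2 * z * G z"
  proof -
    \<comment> \<open>Read m = \<alpha> + \<beta> + 1, k = \<alpha> + 1 and t = \<theta>F; thus b =
      m / (2\<beta>) and c - 1 = k / (2\<beta>).\<close>
    have clear_denom: "m * (2 * \<beta> * t) = m * k * (1 - f) + 4 * \<beta>\<^sup>2 * z * g"
      if "t + k / (2 * \<beta>) * f = k / (2 * \<beta>) + z / (m / (2 * \<beta>)) * g" "m \<noteq> 0" for m k t f g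
    proof -
      have "t = k / (2 * \<beta>) * (1 - f) + 2 * \<beta> * z * g / m"
        using that(1) by (simp add: algebra_simps diff_divide_distrib)
      then show ?thesis
        using that(2) assms(2) by (simp add: distrib_left power2_eq_square)
    qed
    have "?c - 1 = (\<alpha> + 1) / (2 * \<beta>)"
      using assms(2) by (simp add: field_simps)
    then have "z * deriv F z + (\<alpha> + 1) / (2 * \<beta>) * F z = (\<alpha> + 1) / (2 * \<beta>) + z / ?b * G z"
      using hyp1F2_1_contiguous_raise [OF assms(6), of z ?b]
      unfolding F_def G_def e by simp
    then show ?thesis
      using nz(2) by (rule clear_denom)
  qed
  have DF: "((\<lambda>x. F (- (\<eta>\<^sup>2 * cpow L x (2 * \<beta>) / 4))) has_field_derivative
      deriv F z * (2 * \<beta> * z / x)) (at x within S)"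
    unfolding z_def F_def
    by (rule DERIV_chain2 [OF hyp1F2_1_DERIV] derivative_eq_intros cpow_has_field_derivative
        \<open>log_branch S L\<close> x refl)+ simp_all
  have DG: "((\<lambda>x. G (- (\<eta>\<^sup>2 * cpow L x (2 * \<beta>) / 4))) has_field_derivative
      deriv G z * (2 * \<beta> * z / x)) (at x within S)"
    unfolding z_def G_def
    by (rule DERIV_chain2 [OF hyp1F2_1_DERIV] derivative_eq_intros cpow_has_field_derivative
        \<open>log_branch S L\<close> x refl)+ simp_all
  let ?s = "sin (\<eta> * q)" and ?k = "cos (\<eta> * q)"
  let ?B = "(\<alpha> + \<beta> + 1) * ?s * F z - \<beta> * \<eta> * q * ?k * G z"
  \<comment> \<open>\<open>?D\<close> is x times the derivative of the bracket
    \<open>?B\<close>.\<close>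
  let ?D = "(\<alpha> + \<beta> + 1) * (\<beta> * \<eta> * q * ?k * F z + ?s * (2 * \<beta> * (z * deriv F z)))
      - \<beta> * \<eta> * q * (\<beta> * ?k * G z - \<beta> * \<eta> * q * ?s * G z + ?k * (2 * \<beta> * (z * deriv G z)))"
  have N: "(\<alpha> + 1) * ?B + ?D = (\<alpha> + 1) * (\<alpha> + \<beta> + 1) * ?s"
  proof -
    \<comment> \<open>Here w = \<eta>q and t = 2\<beta>\<theta>F, while 2\<beta>\<theta>G is already
      replaced by m (f - g). The cosine terms in f cancel at once, and those in g because m = k +
      \<beta>. In the sine terms, 4z = -w^2 cancels g and leaves k m s.\<close>
    have ident: "k * (m * s * f - \<beta> * w * c * g) + (m * (\<beta> * w * c * f + s * t)
        - \<beta> * w * (\<beta> * c * g - \<beta> * w * s * g + c * (m * (f - g)))) = k * m * s"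
      if t: "m * t = m * k * (1 - f) + 4 * \<beta>\<^sup>2 * z * g" and z: "4 * z = - w\<^sup>2" and m: "m = k + \<beta>"
      for k m s f w c g t
    proof -
      have "4 * \<beta>\<^sup>2 * z * g = \<beta>\<^sup>2 * (4 * z) * g"
        by simp
      with t z have "m * t = m * k * (1 - f) - \<beta>\<^sup>2 * w\<^sup>2 * g"
        by simp
      \<comment> \<open>Multiplied by \<open>s\<close>, the relation matches the sine monomials of
        the goal.\<close>
      then have "s * (m * t) = s * (m * k * (1 - f) - \<beta>\<^sup>2 * w\<^sup>2 * g)"
        by simp
      then show ?thesis
        unfolding m by (simp add: algebra_simps power2_eq_square)
    qed
    have "4 * z = - (\<eta> * q)\<^sup>2"
      by (simp add: z_def q2 power_mult_distrib)
    moreover have "\<alpha> + \<beta> + 1 = \<alpha> + 1 + \<beta>"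
      by simp
    ultimately show ?thesis
      using ident [OF contigF, of "\<eta> * q" ?s ?k] unfolding contigG mult.assoc [of \<beta> \<eta> q] by iprover
  qed
  let ?K = "(\<alpha> + 1) * (\<alpha> + \<beta> + 1)"
  have DA: "((\<lambda>x. cpow L x (\<alpha> + 1) / ?K) has_field_derivative (\<alpha> + 1) * p / ?K) (at x within S)"
    using DERIV_cdivide [OF cpow_has_field_derivative [OF \<open>log_branch S L\<close> x, of "\<alpha> + 1"], of ?K] x0
    by (simp add: p1)
  have DB: "((\<lambda>x. (\<alpha> + \<beta> + 1) * sin (\<eta> * cpow L x \<beta>) * F (- (\<eta>\<^sup>2 * cpow L x (2 * \<beta>) / 4))
        - \<beta> * \<eta> * cpow L x \<beta> * cos (\<eta> * cpow L x \<beta>) * G (- (\<eta>\<^sup>2 * cpow L x (2 * \<beta>) / 4)))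
      has_field_derivative ?D / x) (at x within S)"
    by (rule derivative_eq_intros DF DG cpow_has_field_derivative \<open>log_branch S L\<close> x refl)+
      (simp only: q_def [symmetric] z_def [symmetric],
        simp add: algebra_simps add_divide_distrib diff_divide_distrib)
  \<comment> \<open>The product rule in letters: the \<open>x\<close> in
    \<open>cpow L x (\<alpha> + 1) = x * p\<close> cancels the 1 / x in the derivative of the
    bracket.\<close>
  have "r * p / K * B + D / x * (x * p / K) = p / K * (r * B + D)" for r B D K
    using x0 by (simp add: algebra_simps add_divide_distrib)
  then have "(\<alpha> + 1) * p / ?K * ?B + ?D / x * (cpow L x (\<alpha> + 1) / ?K) = p / ?K * ((\<alpha> + 1) * ?B + ?D)"
    unfolding p1 .
  also have "\<dots> = p * ?s"
    unfolding N using nz by simp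
  finally have "(\<alpha> + 1) * p / ?K * ?B + ?D / x * (cpow L x (\<alpha> + 1) / ?K) = p * ?s" .
  with DERIV_mult [OF DA DB] show "((\<lambda>x. cpow L x (\<alpha> + 1) / ?K *
      ((\<alpha> + \<beta> + 1) * sin (\<eta> * cpow L x \<beta>) * hyp1F2 1 ?b ?c (- (\<eta>\<^sup>2 * cpow L x (2 * \<beta>) / 4))
        - \<beta> * \<eta> * cpow L x \<beta> * cos (\<eta> * cpow L x \<beta>) *
          hyp1F2 1 ?c ?e (- (\<eta>\<^sup>2 * cpow L x (2 * \<beta>) / 4))))
      has_field_derivative cpow L x \<alpha> * sin (\<eta> * cpow L x \<beta>)) (at x within S)"
    by (simp only: F_def [symmetric] G_def [symmetric] p_def [symmetric] q_def [symmetric]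
        z_def [symmetric])
qed

end
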